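(* Let $P\in\mathbb{Z}[x]$ be a monic polynomial of degree $d$ with constant coefficient $a_0=\pm1$ and roots $\alpha_1,\dots,\alpha_d$, let $R$ be the ring of integers of the splitting field of $P$, and let $k$ and $n>1$ be integers. For each $j$ let $m_j$ be the order of (the class of) $\alpha_j$ in the group $(R/kR)^\times$. If $m_j\mid\phi(n)$ for some $j$, then $k\mid U(n)$.
   Context: $\phi$ is Euler's totient function. For $n>1$ let $\mathcal{D}_+(n)=\{m\mid n:\mu(n/m)=1\}$ and $\mathcal{D}_-(n)=\{m\mid n:\mu(n/m)=-1\}$ ($\mu$ the Möbius function), each with $r=2^{l-1}$ elements when $n$ has $l$ distinct prime factors. For a multiset $\mathcal{N}=\{n_1,\dots,n_r\}$ of positive integers let $P_{\mathcal{N}}(x)=\prod_{j_1,\dots,j_r=1}^d(x-\alpha_{j_1}^{n_1}\cdots\alpha_{j_r}^{n_r})\in\mathbb{Z}[x]$, and $U(n):=\operatorname{Res}(P_{\mathcal{D}_+(n)},P_{\mathcal{D}_-(n)})$, where for monic $A,B$, $\operatorname{Res}(A,B)=\prod_{A(a)=0,B(b)=0}(a-b)$. *)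

theory Defs
  imports
    "HOL-Computational_Algebra.Computational_Algebra"
    "HOL-Computational_Algebra.Squarefree"
    "HOL-Number_Theory.Number_Theory"
    "HOL-Combinatorics.List_Permutation"
    "HOL-Algebra.Generated_Fields"
    "HOL-Algebra.Algebraic_Closure_Type"
begin

definition moebius_mu :: "nat \<Rightarrow> int" where
  "moebius_mu n = (if squarefree n then (- 1) ^ card (prime_factors n) else 0)"

definition D_plus :: "nat \<Rightarrow> nat set" where
  "D_plus n = {m. m dvd n \<and> moebius_mu (n div m) = 1}"

definition D_minus :: "nat \<Rightarrow> nat set" where
  "D_minus n = {m. m dvd n \<and> moebius_mu (n div m) = - 1}"

text \<open>
  The polynomial \<open>P\<^sub>N\<close> for the roots \<open>\<alpha> 1, \<dots>, \<alpha> d\<close> of \<open>P\<close>, listed with multiplicity.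
  The tuples \<open>(j\<^sub>1, \<dots>, j\<^sub>r)\<close> are the functions from \<open>{..<r}\<close> to \<open>{1..d}\<close>. The result does not
  depend on how \<open>N\<close> is enumerated (\<open>P_mset_enum\<close> below). It has integer coefficients, but is
  formed over the complex numbers.
\<close>

definition P_list :: "nat \<Rightarrow> (nat \<Rightarrow> complex) \<Rightarrow> nat list \<Rightarrow> complex poly" where
  "P_list d \<alpha> ns =
     (\<Prod>j \<in> {..<length ns} \<rightarrow>\<^sub>E {1..d}. [:- (\<Prod>i<length ns. \<alpha> (j i) ^ (ns ! i)), 1:])"

definition P_mset :: "nat \<Rightarrow> (nat \<Rightarrow> complex) \<Rightarrow> nat multiset \<Rightarrow> complex poly" where
  "P_mset d \<alpha> N = P_list d \<alpha> (sorted_list_of_multiset N)"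

text \<open>The resultant of two monic polynomials; \<^const>\<open>proots\<close> counts roots with multiplicity.\<close>

definition Res :: "complex poly \<Rightarrow> complex poly \<Rightarrow> complex" where
  "Res A B = (\<Prod>a\<in>#proots A. \<Prod>b\<in>#proots B. a - b)"

definition U :: "nat \<Rightarrow> (nat \<Rightarrow> complex) \<Rightarrow> nat \<Rightarrow> complex" where
  "U d \<alpha> n = Res (P_mset d \<alpha> (mset_set (D_plus n))) (P_mset d \<alpha> (mset_set (D_minus n)))"

abbreviation complex_ring :: "complex ring" where
  "complex_ring \<equiv> ring_of_type_algebra"

definition splitting_field :: "int poly \<Rightarrow> complex set" where
  "splitting_field P =
     generate_field complex_ring (\<rat> \<union> {z. poly (map_poly of_int P) z = 0})"

definition ring_of_integers :: "complex set \<Rightarrow> complex ring" where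
  "ring_of_integers K = complex_ring \<lparr>carrier := {z \<in> K. algebraic_int z}\<rparr>"

definition quot_units :: "complex ring \<Rightarrow> int \<Rightarrow> complex set monoid" where
  "quot_units R k = units_of (R Quot (PIdl\<^bsub>R\<^esub> (of_int k)))"

text \<open>
  The order of the class of \<open>z\<close> in \<open>(R/kR)\<^sup>\<times>\<close>; \<^const>\<open>group.ord\<close> is \<open>0\<close> for an element of
  infinite order, which can occur only for \<open>k = 0\<close>.
\<close>

definition class_order :: "complex ring \<Rightarrow> int \<Rightarrow> complex \<Rightarrow> nat" where
  "class_order R k z = group.ord (quot_units R k) (PIdl\<^bsub>R\<^esub> (of_int k) +>\<^bsub>R\<^esub> z)"

lemma P_list_cong_mset:
  assumes "mset xs = mset ys"
  shows "P_list d \<alpha> xs = P_list d \<alpha> ys"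
proof -
  define n where "n = length ys"
  have len: "length xs = n" using assms unfolding n_def by (rule mset_eq_length)
  obtain p where p: "p permutes {..<n}" and xs: "permute_list p ys = xs"
    using mset_eq_permutation[OF assms] unfolding n_def by blast
  have nth: "xs ! i = ys ! p i" if "i < n" for i
    using xs p that permute_list_nth[of p ys i] by (auto simp: n_def)
  have bij: "bij_betw p {..<n} {..<n}" using p by (rule permutes_imp_bij)
  define T where "T = {..<n} \<rightarrow>\<^sub>E {1..d}"
  define h where "h = (\<lambda>j. restrict (j \<circ> p) {..<n} :: nat \<Rightarrow> nat)"
  define q where "q = inv_into UNIV p"
  have q: "q permutes {..<n}" unfolding q_def using p by (rule permutes_inv)
  define g where "g = (\<lambda>j. restrict (j \<circ> q) {..<n} :: nat \<Rightarrow> nat)"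
  have pq: "p (q i) = i" "q (p i) = i" for i
    unfolding q_def using permutes_inverses[OF p] by auto
  have pin: "p i < n" if "i < n" for i using permutes_in_image[OF p, of i] that by simp
  have qin: "q i < n" if "i < n" for i using permutes_in_image[OF q, of i] that by simp
  have bijh: "bij_betw h T T"
  proof (rule bij_betw_byWitness[of _ g])
    show "\<forall>a\<in>T. g (h a) = a" "\<forall>a\<in>T. h (g a) = a"
      unfolding g_def h_def T_def
      by (auto simp: fun_eq_iff pq pin qin restrict_def PiE_def extensional_def)
    show "h ` T \<subseteq> T" "g ` T \<subseteq> T"
      unfolding g_def h_def T_def using pin qin by (force simp: PiE_def Pi_def)+
  qed
  have "P_list d \<alpha> ys = (\<Prod>j\<in>T. [:- (\<Prod>i<n. \<alpha> (j i) ^ (ys ! i)), 1:])"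
    by (simp add: P_list_def T_def n_def)
  also have "\<dots> = (\<Prod>j\<in>T. [:- (\<Prod>i<n. \<alpha> (j (p i)) ^ (ys ! p i)), 1:])"
    by (intro prod.cong refl, subst prod.reindex_bij_betw[OF bij, symmetric]) simp
  also have "\<dots> = (\<Prod>j\<in>T. [:- (\<Prod>i<n. \<alpha> (h j i) ^ (xs ! i)), 1:])"
    by (intro prod.cong arg_cong[where f = "\<lambda>c. [:- c, 1:]"] refl) (simp add: h_def nth)
  also have "\<dots> = (\<Prod>j\<in>T. [:- (\<Prod>i<n. \<alpha> (j i) ^ (xs ! i)), 1:])"
    by (rule prod.reindex_bij_betw[OF bijh])
  also have "\<dots> = P_list d \<alpha> xs"
    by (simp add: P_list_def T_def len)
  finally show ?thesis by simp
qed

lemma P_mset_enum: "P_mset d \<alpha> (mset ns) = P_list d \<alpha> ns"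
  unfolding P_mset_def by (rule P_list_cong_mset) simp

end

theory Submission
  imports Defs "Jordan_Normal_Form.Char_Poly"
begin

text \<open>
  \<open>U n\<close> is a product of differences \<open>f s - g t\<close>, where \<open>f s\<close> and \<open>g t\<close> run through the products
  of powers of the roots. The factor in which all roots are taken to be \<open>\<alpha> j\<close> equals
  \<open>\<alpha> j ^ \<Sum>D\<^sub>- * (\<alpha> j ^ \<phi>(n) - 1)\<close>, because \<open>\<Sum>D\<^sub>+ - \<Sum>D\<^sub>- = (\<Sum>m | m dvd n. \<mu>(n/m) * m) = \<phi>(n)\<close>.
  The hypothesis on the order makes this factor a multiple of \<open>k\<close> in the ring of integers, so \<open>U n\<close> is
  \<open>k\<close> times an algebraic integer. It remains to see that \<open>U n\<close> is rational. No Galois theory is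
  needed for this: the power sums of the family of all \<open>f s - g t\<close> are polynomials in the power sums of the
  roots, and Newton's identities translate rational power sums into rational elementary
  symmetric functions and back.
\<close>

subsection \<open>Algebraic integers form a ring\<close>

text \<open>The characteristic polynomial of an integer matrix is monic with integer coefficients,
  and it vanishes at every eigenvalue.\<close>

lemma algebraic_int_eigenvalue:
  fixes A :: "int mat" and z :: "'a :: field_char_0"
  assumes A: "A \<in> carrier_mat n n" and ev: "eigenvalue (map_mat of_int A) z"
  shows "algebraic_int z"
  unfolding algebraic_int_altdef_ipoly
proof (intro exI conjI)
  have "map_mat of_int A \<in> carrier_mat n n" using A by simp
  with ev have "poly (char_poly (map_mat of_int A)) z = 0"
    by (simp add: eigenvalue_root_char_poly)
  then show "poly (map_poly of_int (char_poly A)) z = 0"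
    by (simp add: of_int_hom.char_poly_hom[OF A])
  show "lead_coeff (char_poly A) = 1" using degree_monic_char_poly[OF A] by simp
qed

text \<open>The relations say that the family \<open>v\<close>, nonzero because of
  \<open>i0\<close>, is an eigenvector of the integer matrix \<open>A\<close>. Enumerating the index
  set turns this into a statement about matrices.\<close>

lemma algebraic_int_eigenvector:
  fixes v :: "'i \<Rightarrow> 'a :: field_char_0"
  assumes fin: "finite I" and nz: "i0 \<in> I" "v i0 \<noteq> 0"
    and ev: "\<And>i. i \<in> I \<Longrightarrow> z * v i = (\<Sum>j\<in>I. of_int (A i j) * v j)"
  shows "algebraic_int z"
proof -
  define n where "n = card I"
  obtain h where h: "bij_betw h {..<n} I"
    unfolding n_def using ex_bij_betw_nat_finite[OF fin] by (auto simp: lessThan_atLeast0)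
  define M where "M = mat n n (\<lambda>(i, j). A (h i) (h j))"
  define w where "w = vec n (\<lambda>i. v (h i))"
  have M: "M \<in> carrier_mat n n" by (simp add: M_def)
  have "map_mat of_int M *\<^sub>v w = z \<cdot>\<^sub>v w"
  proof (intro eq_vecI)
    fix i assume "i < dim_vec (z \<cdot>\<^sub>v w)"
    then have i: "i < n" by (simp add: w_def)
    then have "h i \<in> I" using h by (auto simp: bij_betw_def)
    have "(map_mat of_int M *\<^sub>v w) $ i = (\<Sum>j<n. of_int (A (h i) (h j)) * v (h j))"
      using i by (simp add: M_def w_def scalar_prod_def lessThan_atLeast0)
    also have "\<dots> = (\<Sum>j\<in>I. of_int (A (h i) j) * v j)"
      by (rule sum.reindex_bij_betw[OF h])
    finally show "(map_mat of_int M *\<^sub>v w) $ i = (z \<cdot>\<^sub>v w) $ i"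
      using ev[OF \<open>h i \<in> I\<close>] i by (simp add: w_def)
  qed (simp_all add: M_def w_def)
  moreover have "w \<noteq> 0\<^sub>v n"
  proof
    assume "w = 0\<^sub>v n"
    obtain i where "i < n" "h i = i0" using h nz by (auto simp: bij_betw_def)
    then show False using \<open>w = 0\<^sub>v n\<close> nz by (auto simp: w_def vec_eq_iff)
  qed
  ultimately have "eigenvalue (map_mat of_int M) z"
    unfolding eigenvalue_def eigenvector_def by (intro exI[of _ w]) (simp add: M_def w_def)
  with M show ?thesis by (rule algebraic_int_eigenvalue)
qed

definition int_span :: "('i \<Rightarrow> 'a :: ring_1) \<Rightarrow> 'i set \<Rightarrow> 'a set" where
  "int_span v I = {(\<Sum>i\<in>I. of_int (c i) * v i) | c. True}"

lemma int_spanI: "x = (\<Sum>i\<in>I. of_int (c i) * v i) \<Longrightarrow> x \<in> int_span v I"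
  by (auto simp: int_span_def)

lemma int_span_base: "finite I \<Longrightarrow> i \<in> I \<Longrightarrow> v i \<in> int_span v I"
  by (rule int_spanI[where c = "\<lambda>j. if j = i then 1 else 0"])
     (simp add: if_distrib[of of_int] if_distrib[of "\<lambda>x. x * _"] cong: if_cong)

lemma int_span_add: "x \<in> int_span v I \<Longrightarrow> y \<in> int_span v I \<Longrightarrow> x + y \<in> int_span v I"
proof -
  assume "x \<in> int_span v I" "y \<in> int_span v I"
  then obtain a b where "x = (\<Sum>i\<in>I. of_int (a i) * v i)" "y = (\<Sum>i\<in>I. of_int (b i) * v i)"
    by (auto simp: int_span_def)
  then have "x + y = (\<Sum>i\<in>I. of_int (a i + b i) * v i)"
    by (simp add: sum.distrib distrib_right)
  then show ?thesis by (rule int_spanI)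
qed

lemma int_span_of_int: "x \<in> int_span v I \<Longrightarrow> of_int a * x \<in> int_span v I"
proof -
  assume "x \<in> int_span v I"
  then obtain b where "x = (\<Sum>i\<in>I. of_int (b i) * v i)"
    by (auto simp: int_span_def)
  then have "of_int a * x = (\<Sum>i\<in>I. of_int (a * b i) * v i)"
    by (simp add: sum_distrib_left mult.assoc)
  then show ?thesis by (rule int_spanI)
qed

lemma int_span_sum:
  "(\<And>j. j \<in> J \<Longrightarrow> f j \<in> int_span v I) \<Longrightarrow> (\<Sum>j\<in>J. f j) \<in> int_span v I"
  by (induction J rule: infinite_finite_induct)
     (auto intro: int_span_add int_spanI[where c = "\<lambda>_. 0"])

text \<open>The usual criterion: multiplication by \<open>z\<close> maps a nonzero finitely
  generated subgroup into itself, so its action on the generators is given by an integer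
  matrix.\<close>

lemma algebraic_int_int_span:
  fixes z :: "'a :: field_char_0"
  assumes fin: "finite I" and nz: "i0 \<in> I" "v i0 \<noteq> 0"
    and ev: "\<And>i. i \<in> I \<Longrightarrow> z * v i \<in> int_span v I"
  shows "algebraic_int z"
proof -
  have "\<forall>i\<in>I. \<exists>c. z * v i = (\<Sum>j\<in>I. of_int (c j) * v j)"
    using ev by (auto simp: int_span_def)
  then obtain A where "\<forall>i\<in>I. z * v i = (\<Sum>j\<in>I. of_int (A i j) * v j)"
    by (rule bchoice[elim_format]) blast
  then show ?thesis by (intro algebraic_int_eigenvector[where v = v and A = A, OF fin nz]) simp
qed

lemma algebraic_int_power_reduce:
  fixes x :: "'a :: field_char_0"
  assumes "algebraic_int x"
  obtains n c where "n > 0" "x ^ n = (\<Sum>i<n. of_int (c i) * x ^ i)"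
proof -
  from assms obtain p where p: "poly (map_poly of_int p) x = 0" "lead_coeff p = 1"
    unfolding algebraic_int_altdef_ipoly by blast
  define n where "n = Polynomial.degree p"
  have "0 = (\<Sum>i\<le>n. of_int (Polynomial.coeff p i) * x ^ i)"
    using p by (simp add: poly_altdef n_def degree_map_poly coeff_map_poly)
  also have "\<dots> = (\<Sum>i<n. of_int (Polynomial.coeff p i) * x ^ i) + x ^ n"
    using p by (simp add: n_def lessThan_Suc_atMost[symmetric])
  finally have "x ^ n = - (\<Sum>i<n. of_int (Polynomial.coeff p i) * x ^ i)"
    by (simp add: eq_neg_iff_add_eq_0 add.commute)
  then have eq: "x ^ n = (\<Sum>i<n. of_int (- Polynomial.coeff p i) * x ^ i)"
    by (simp add: sum_negf)
  \<comment> \<open>For \<open>n = 0\<close> the equation would read 1 = 0.\<close>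
  from eq have "n > 0" by (cases n) auto
  then show ?thesis using eq by (rule that)
qed

text \<open>The monomials x^i y^j with i < n and j < m generate a subgroup stable under both
  \<open>x\<close> and \<open>y\<close>: multiplication raises one exponent, and an exponent
  reaching n or m is lowered by the monic equation. Having one subgroup for both elements makes it
  stable under their sum and product as well.\<close>

lemma algebraic_int_common_span:
  fixes x y :: "'a :: field_char_0"
  assumes "algebraic_int x" "algebraic_int y"
  obtains I :: "(nat \<times> nat) set" and v i0
  where "finite I" "i0 \<in> I" "v i0 \<noteq> (0 :: 'a)"
    "\<And>u. u \<in> int_span v I \<Longrightarrow> x * u \<in> int_span v I"
    "\<And>u. u \<in> int_span v I \<Longrightarrow> y * u \<in> int_span v I"
proof -
  obtain n c where n: "n > 0" "x ^ n = (\<Sum>i<n. of_int (c i) * x ^ i)"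
    using algebraic_int_power_reduce[OF assms(1)] .
  obtain m e where m: "m > 0" "y ^ m = (\<Sum>i<m. of_int (e i) * y ^ i)"
    using algebraic_int_power_reduce[OF assms(2)] .
  define I where "I = {..<n} \<times> {..<m}"
  define v where "v = (\<lambda>(i, j). x ^ i * y ^ j)"
  have fin: "finite I" by (simp add: I_def)
  have base: "x ^ i * y ^ j \<in> int_span v I" if "i < n" "j < m" for i j
    using int_span_base[OF fin, of "(i, j)" v] that by (simp add: I_def v_def)
  have xb: "x * v k \<in> int_span v I" if k: "k \<in> I" for k
  proof -
    obtain i j where ij: "k = (i, j)" "i < n" "j < m" using k by (auto simp: I_def)
    show ?thesis
    proof (cases "Suc i < n")
      case True
      then show ?thesis using base[of "Suc i" j] ij by (simp add: v_def mult.assoc)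
    next
      case False
      with ij have "Suc i = n" by simp
      then have "x * v k = x ^ n * y ^ j" using ij by (auto simp: v_def)
      also have "\<dots> = (\<Sum>i<n. of_int (c i) * (x ^ i * y ^ j))"
        by (simp add: n sum_distrib_right mult.assoc)
      finally show ?thesis using ij base by (auto intro!: int_span_sum int_span_of_int)
    qed
  qed
  have yb: "y * v k \<in> int_span v I" if k: "k \<in> I" for k
  proof -
    obtain i j where ij: "k = (i, j)" "i < n" "j < m" using k by (auto simp: I_def)
    show ?thesis
    proof (cases "Suc j < m")
      case True
      then show ?thesis using base[of i "Suc j"] ij by (simp add: v_def mult_ac)
    next
      case False
      with ij have "Suc j = m" by simp
      then have "y * v k = x ^ i * y ^ m" using ij by (auto simp: v_def)
      also have "\<dots> = (\<Sum>j<m. of_int (e j) * (x ^ i * y ^ j))"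
        by (simp add: m sum_distrib_left mult_ac)
      finally show ?thesis using ij base by (auto intro!: int_span_sum int_span_of_int)
    qed
  qed
  have lift: "z * u \<in> int_span v I"
    if z: "\<And>k. k \<in> I \<Longrightarrow> z * v k \<in> int_span v I" and u: "u \<in> int_span v I" for z u
  proof -
    obtain a where "u = (\<Sum>i\<in>I. of_int (a i) * v i)" using u by (auto simp: int_span_def)
    then have "z * u = (\<Sum>i\<in>I. of_int (a i) * (z * v i))"
      by (simp add: sum_distrib_left mult_ac)
    then show ?thesis using z by (auto intro!: int_span_sum int_span_of_int)
  qed
  show ?thesis
  proof (rule that)
    show "finite I" "(0, 0) \<in> I" "v (0, 0) \<noteq> 0" using fin n(1) m(1) by (auto simp: I_def v_def)
  qed (rule lift[OF xb] lift[OF yb]; assumption)+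
qed

lemma algebraic_int_add:
  fixes x y :: "'a :: field_char_0"
  assumes "algebraic_int x" "algebraic_int y"
  shows "algebraic_int (x + y)"
proof -
  obtain I :: "(nat \<times> nat) set" and v i0 where s: "finite I" "i0 \<in> I" "v i0 \<noteq> (0 :: 'a)"
    "\<And>u. u \<in> int_span v I \<Longrightarrow> x * u \<in> int_span v I"
    "\<And>u. u \<in> int_span v I \<Longrightarrow> y * u \<in> int_span v I"
    by (rule algebraic_int_common_span[OF assms]) (rule that)
  show ?thesis
    by (rule algebraic_int_int_span[where v = v, OF s(1-3)])
       (unfold distrib_right, intro int_span_add s(4,5) int_span_base s(1), assumption+)
qed

lemma algebraic_int_mult:
  fixes x y :: "'a :: field_char_0"
  assumes "algebraic_int x" "algebraic_int y"
  shows "algebraic_int (x * y)"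
proof -
  obtain I :: "(nat \<times> nat) set" and v i0 where s: "finite I" "i0 \<in> I" "v i0 \<noteq> (0 :: 'a)"
    "\<And>u. u \<in> int_span v I \<Longrightarrow> x * u \<in> int_span v I"
    "\<And>u. u \<in> int_span v I \<Longrightarrow> y * u \<in> int_span v I"
    by (rule algebraic_int_common_span[OF assms]) (rule that)
  show ?thesis
    by (rule algebraic_int_int_span[where v = v, OF s(1-3)])
       (unfold mult.assoc, intro s(4,5) int_span_base s(1), assumption)
qed

lemma algebraic_int_diff:
  fixes x y :: "'a :: field_char_0"
  shows "algebraic_int x \<Longrightarrow> algebraic_int y \<Longrightarrow> algebraic_int (x - y)"
  using algebraic_int_add[of x "- y"] by simp

lemma algebraic_int_prod:
  fixes f :: "'b \<Rightarrow> 'a :: field_char_0"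
  shows "(\<And>i. i \<in> I \<Longrightarrow> algebraic_int (f i)) \<Longrightarrow> algebraic_int (\<Prod>i\<in>I. f i)"
  by (induction I rule: infinite_finite_induct) (auto intro: algebraic_int_mult)

lemma algebraic_int_power:
  fixes x :: "'a :: field_char_0"
  shows "algebraic_int x \<Longrightarrow> algebraic_int (x ^ n)"
  by (induction n) (auto intro: algebraic_int_mult)

subsection \<open>Power sums and rationality\<close>

text \<open>Newton's identities as a single equation of power series. It is the logarithmic
  derivative of the product: a factor 1 - aX contributes -a / (1 - aX), which is minus the series
  with coefficients a^(k+1).\<close>

lemma fps_deriv_prod_one_minus:
  fixes f :: "'t \<Rightarrow> 'a :: field"
  assumes "finite T"
  defines "Q \<equiv> \<lambda>T. (\<Prod>t\<in>T. 1 - fps_const (f t) * fps_X)"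
  shows "fps_deriv (Q T) = - Q T * Abs_fps (\<lambda>k. \<Sum>t\<in>T. f t ^ Suc k)"
  using assms(1)
proof (induction T rule: finite_induct)
  case empty
  then show ?case by (simp add: Q_def fps_eq_iff)
next
  case (insert t T)
  define L where "L = 1 - fps_const (f t) * fps_X"
  define g where "g = Abs_fps (\<lambda>k. f t ^ Suc k)"
  \<comment> \<open>Geometric series. It lets the derivative of \<open>L\<close> be written as
    \<open>- L * g\<close>, so that the product rule yields the common factor
    \<open>L * Q T\<close>.\<close>
  have Lg: "L * g = fps_const (f t)"
  proof (rule fps_ext)
    fix n show "(L * g) $ n = fps_const (f t) $ n"
      by (cases n) (simp_all add: L_def g_def left_diff_distrib mult.assoc)
  qed
  have Q: "Q (insert t T) = L * Q T" using insert by (simp add: Q_def L_def)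
  have G: "Abs_fps (\<lambda>k. \<Sum>t\<in>insert t T. f t ^ Suc k) = g + Abs_fps (\<lambda>k. \<Sum>t\<in>T. f t ^ Suc k)"
    using insert by (simp add: fps_eq_iff g_def)
  have "fps_deriv L = - fps_const (f t)" by (simp add: L_def)
  then show ?case
    unfolding Q G fps_deriv_mult insert.IH by (simp add: algebra_simps flip: Lg)
qed

lemma fps_nth_prod_0: "(\<Prod>t\<in>T. F t :: 'a :: comm_ring_1 fps) $ 0 = (\<Prod>t\<in>T. F t $ 0)"
  by (induction T rule: infinite_finite_induct) simp_all

text \<open>Reversing the coefficients of x - a gives 1 - aX. The series in Newton's identities
  therefore has the coefficients of the monic polynomial in reverse order.\<close>

lemma fps_of_poly_reflect_prod:
  "fps_of_poly (reflect_poly (\<Prod>t\<in>T. [:- f t, 1:])) = (\<Prod>t\<in>T. 1 - fps_const (f t :: 'a :: field) * fps_X)"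
proof -
  have "fps_of_poly (reflect_poly [:- a, 1:]) = 1 - fps_const a * fps_X" for a :: 'a
    by (rule fps_ext) (auto simp: reflect_poly_def fps_of_poly_pCons)
  then show ?thesis by (simp only: reflect_poly_prod fps_of_poly_prod)
qed

text \<open>Newton's identities solved for the power sums: \<open>Q\<close> has constant term 1, so
  coefficient k of Q' = -QG expresses \<open>G $ k\<close> through coefficients of \<open>Q\<close>
  and earlier coefficients of \<open>G\<close>.\<close>

lemma Rats_power_sums_if_coeffs:
  fixes f :: "'t \<Rightarrow> 'a :: field_char_0"
  assumes fin: "finite T" and rat: "\<And>i. Polynomial.coeff (\<Prod>t\<in>T. [:- f t, 1:]) i \<in> \<rat>"
  shows "(\<Sum>t\<in>T. f t ^ m) \<in> \<rat>"
proof -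
  define Q where "Q = (\<Prod>t\<in>T. 1 - fps_const (f t) * fps_X)"
  define G where "G = Abs_fps (\<lambda>k. \<Sum>t\<in>T. f t ^ Suc k)"
  have deriv: "fps_deriv Q = - Q * G"
    unfolding Q_def G_def using fin by (rule fps_deriv_prod_one_minus)
  have Qr: "Q $ i \<in> \<rat>" for i
    using rat unfolding Q_def fps_of_poly_reflect_prod[symmetric]
    by (auto simp: coeff_reflect_poly)
  have Q0: "Q $ 0 = 1" by (simp add: Q_def fps_nth_prod_0)
  have "G $ k \<in> \<rat>" for k
  proof (induction k rule: less_induct)
    case (less k)
    have "of_nat (Suc k) * Q $ Suc k = (- Q * G) $ k"
      unfolding deriv[symmetric] by (simp add: fps_deriv_nth)
    also have "\<dots> = - (\<Sum>i=0..k. Q $ i * G $ (k - i))"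
      by (simp add: fps_mult_nth)
    also have "(\<Sum>i=0..k. Q $ i * G $ (k - i)) = G $ k + (\<Sum>i=1..k. Q $ i * G $ (k - i))"
      by (simp add: sum.atLeast_Suc_atMost Q0)
    finally have "G $ k = - (of_nat (Suc k) * Q $ Suc k) - (\<Sum>i=1..k. Q $ i * G $ (k - i))"
      by (simp only: minus_add_distrib minus_minus diff_minus_eq_add) simp
    also have "\<dots> \<in> \<rat>"
      by (intro Rats_diff Rats_minus_iff[THEN iffD2] Rats_mult Rats_of_nat Qr Rats_sum less) auto
    finally show ?case .
  qed
  \<comment> \<open>The series \<open>G\<close> starts with the first powers; the power sum for
    \<open>m = 0\<close> is the cardinality of \<open>T\<close>.\<close>
  then show ?thesis by (cases m) (auto simp: G_def)
qed

text \<open>Newton's identities solved in the other direction: rational power sums give rational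
  coefficients, and the product is one of these up to sign.\<close>

lemma Rats_prod_if_power_sums:
  fixes f :: "'t \<Rightarrow> 'a :: field_char_0"
  assumes fin: "finite T" and rat: "\<And>m. (\<Sum>t\<in>T. f t ^ m) \<in> \<rat>"
  shows "(\<Prod>t\<in>T. f t) \<in> \<rat>"
proof -
  define q where "q = (\<Prod>t\<in>T. [:- f t, 1:])"
  define Q where "Q = (\<Prod>t\<in>T. 1 - fps_const (f t) * fps_X)"
  define G where "G = Abs_fps (\<lambda>k. \<Sum>t\<in>T. f t ^ Suc k)"
  have Gr: "G $ k \<in> \<rat>" for k unfolding G_def fps_nth_Abs_fps by (rule rat)
  have deriv: "fps_deriv Q = - Q * G"
    unfolding Q_def G_def using fin by (rule fps_deriv_prod_one_minus)
  have Q0: "Q $ 0 = 1" by (simp add: Q_def fps_nth_prod_0)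
  have Qr: "Q $ k \<in> \<rat>" for k
  proof (induction k rule: less_induct)
    case (less k)
    show ?case
    proof (cases k)
      case (Suc l)
      have "of_nat (Suc l) * Q $ Suc l = (- Q * G) $ l"
        unfolding deriv[symmetric] by (simp add: fps_deriv_nth)
      also have "\<dots> = - (\<Sum>i=0..l. Q $ i * G $ (l - i))"
        by (simp add: fps_mult_nth)
      \<comment> \<open>The division by l + 1 is possible in characteristic zero.\<close>
      finally have "Q $ Suc l = - (\<Sum>i=0..l. Q $ i * G $ (l - i)) / of_nat (Suc l)"
        by (simp add: field_simps del: of_nat_Suc)
      also have "\<dots> \<in> \<rat>"
        using less Gr unfolding Suc
        by (intro Rats_divide Rats_minus_iff[THEN iffD2] Rats_mult Rats_of_nat Rats_sum) auto
      finally show ?thesis by (simp add: Suc)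
    qed (simp add: Q0)
  qed
  \<comment> \<open>Reversal moves the constant coefficient of \<open>q\<close> to position
    \<open>degree q\<close>.\<close>
  have "Q $ Polynomial.degree q = Polynomial.coeff q 0"
    unfolding Q_def fps_of_poly_reflect_prod[symmetric] by (simp add: q_def coeff_reflect_poly)
  also have "\<dots> = (\<Prod>t\<in>T. - f t)"
    by (simp add: q_def flip: poly_0_coeff_0) (simp add: poly_prod)
  also have "\<dots> = (-1) ^ card T * (\<Prod>t\<in>T. f t)"
    using prod.distrib[of "\<lambda>_. - 1" f T] by simp
  finally have "(-1) ^ card T * Q $ Polynomial.degree q = (\<Prod>t\<in>T. f t)"
    by (simp add: mult.assoc[symmetric] flip: power_add)
  then show ?thesis using Qr by (metis Rats_mult Rats_power Rats_minus_iff Rats_1)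
qed

text \<open>By the binomial theorem, a power sum of the differences is an integer combination of
  products of a power sum of \<open>f\<close> and one of \<open>g\<close>. The preceding lemma then
  applies to the family indexed by \<open>S \<times> T\<close>.\<close>

lemma Rats_power_sums_prod_diff:
  fixes f :: "'s \<Rightarrow> 'a :: field_char_0"
  assumes fin: "finite S" "finite T"
    and f: "\<And>m. (\<Sum>s\<in>S. f s ^ m) \<in> \<rat>" and g: "\<And>m. (\<Sum>t\<in>T. g t ^ m) \<in> \<rat>"
  shows "(\<Prod>s\<in>S. \<Prod>t\<in>T. f s - g t) \<in> \<rat>"
proof -
  have "(\<Sum>(s, t)\<in>S \<times> T. (f s - g t) ^ m) \<in> \<rat>" for m
  proof -
    have "(\<Sum>(s, t)\<in>S \<times> T. (f s - g t) ^ m) =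
        (\<Sum>s\<in>S. \<Sum>t\<in>T. \<Sum>k\<le>m. of_nat (m choose k) * f s ^ k * (- g t) ^ (m - k))"
      unfolding sum.cartesian_product[symmetric] diff_conv_add_uminus binomial_ring ..
    also have "\<dots> = (\<Sum>s\<in>S. \<Sum>k\<le>m. \<Sum>t\<in>T. of_nat (m choose k) * f s ^ k * (- g t) ^ (m - k))"
      by (intro sum.cong refl sum.swap)
    also have "\<dots> = (\<Sum>k\<le>m. \<Sum>s\<in>S. \<Sum>t\<in>T. of_nat (m choose k) * f s ^ k * (- g t) ^ (m - k))"
      by (rule sum.swap)
    also have "\<dots> = (\<Sum>k\<le>m. of_nat (m choose k) * (-1) ^ (m - k) *
        ((\<Sum>s\<in>S. f s ^ k) * (\<Sum>t\<in>T. g t ^ (m - k))))"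
      unfolding sum_product unfolding sum_distrib_left
      by (intro sum.cong refl) (simp add: power_minus[of "g _"] mult_ac)
    also have "\<dots> \<in> \<rat>"
      by (intro Rats_sum Rats_mult Rats_of_nat Rats_power Rats_minus_iff[THEN iffD2] Rats_1 f g)
    finally show ?thesis .
  qed
  then have "(\<Prod>(s, t)\<in>S \<times> T. f s - g t) \<in> \<rat>"
    using Rats_prod_if_power_sums[of "S \<times> T" "\<lambda>(s, t). f s - g t"] fin
    by (simp add: case_prod_unfold)
  then show ?thesis by (simp add: prod.cartesian_product)
qed

section \<open>Resultants as products over index tuples\<close>

definition monomial_value :: "(nat \<Rightarrow> complex) \<Rightarrow> nat list \<Rightarrow> (nat \<Rightarrow> nat) \<Rightarrow> complex" where
  "monomial_value \<alpha> ns j = (\<Prod>i<length ns. \<alpha> (j i) ^ (ns ! i))"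

text \<open>Distributive law: factor i depends only on \<open>j i\<close>, so the sum over all
  tuples splits. Rational power sums of the \<alpha> a thus pass to the roots of
  \<open>P_list\<close>.\<close>

lemma power_sum_monomial_value:
  "(\<Sum>j\<in>{..<length ns} \<rightarrow>\<^sub>E {1..d}. monomial_value \<alpha> ns j ^ m) =
     (\<Prod>i<length ns. \<Sum>a=1..d. \<alpha> a ^ (ns ! i * m))"
  by (simp add: prod_sum_PiE monomial_value_def power_mult prod_power_distrib)

lemma proots_prod_linear:
  fixes f :: "'t \<Rightarrow> 'a :: idom"
  assumes "finite T"
  shows "proots (\<Prod>t\<in>T. [:- f t, 1:]) = image_mset f (mset_set T)"
proof -
  have "lead_coeff (\<Prod>t\<in>T. [:- f t, 1:]) = 1" for T by (simp add: lead_coeff_prod)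
  then have "(\<Prod>t\<in>T. [:- f t, 1:]) \<noteq> 0" for T by (metis leading_coeff_0_iff zero_neq_one)
  with assms show ?thesis
    by induction (simp_all add: proots_mult del: mult_pCons_left)
qed

lemma Res_P_list:
  "Res (P_list d \<alpha> ns) (P_list d \<alpha> ms) =
    (\<Prod>j\<in>{..<length ns} \<rightarrow>\<^sub>E {1..d}. \<Prod>l\<in>{..<length ms} \<rightarrow>\<^sub>E {1..d}.
       monomial_value \<alpha> ns j - monomial_value \<alpha> ms l)"
  unfolding Res_def P_list_def monomial_value_def[symmetric]
  by (subst (1 2) proots_prod_linear)
     (auto intro!: finite_PiE simp: prod_unfold_prod_mset image_mset.compositionality comp_def)

subsection \<open>The totient as a sum over the divisors\<close>

lemma prime_factors_prod_primes:
  fixes B :: "nat set"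
  assumes "finite B" "\<And>p. p \<in> B \<Longrightarrow> Factorial_Ring.prime p"
  shows "prime_factors (\<Prod>B) = B"
proof -
  have "0 \<notin> B" using assms(2) by force
  then have "prime_factors (\<Prod>B) = (\<Union>p\<in>B. prime_factors p)"
    using assms prime_factors_prod[of B "\<lambda>p. p"] by auto
  also have "\<dots> = B" using assms(2) by (auto simp: prime_prime_factors)
  finally show ?thesis .
qed

lemma prod_prime_factors_squarefree:
  fixes m :: nat
  assumes "squarefree m"
  shows "\<Prod>(prime_factors m) = m"
proof -
  have "m \<noteq> 0" using assms by (metis not_squarefree_0)
  then have "(\<Prod>p\<in>prime_factors m. p ^ multiplicity p m) = m" by (simp add: prod_prime_factors)
  moreover have "multiplicity p m = 1" if "p \<in> prime_factors m" for p
  proof -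
    have "multiplicity p m \<le> 1"
      using assms squarefree_factorial_semiring''[OF \<open>m \<noteq> 0\<close>] that by auto
    moreover have "multiplicity p m > 0" using that by (simp add: prime_factors_multiplicity)
    ultimately show ?thesis by simp
  qed
  ultimately show ?thesis by simp
qed

lemma prod_prime_factors_subset_dvd:
  fixes n :: nat
  assumes "B \<subseteq> prime_factors n" "n > 0"
  shows "\<Prod>B dvd n"
proof -
  have "\<Prod>B dvd \<Prod>(prime_factors n)" using assms by (intro prod_dvd_prod_subset) auto
  also have "\<dots> dvd (\<Prod>p\<in>prime_factors n. p ^ multiplicity p n)"
    by (intro prod_dvd_prod) (auto simp: prime_factors_multiplicity)
  also have "\<dots> = n" using assms by (simp add: prod_prime_factors)
  finally show ?thesis .
qed

lemma dvd_div_div_self: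
  fixes n q :: nat
  assumes "q dvd n" "n > 0"
  shows "n div (n div q) = q"
  using assms by (elim dvdE) simp

text \<open>A squarefree number is determined by its set of primes, so the divisors m whose Moebius
  value at n/m is nonzero correspond to the sets of primes dividing n.\<close>

lemma bij_betw_squarefree_codivisors:
  fixes n :: nat
  assumes "n > 0"
  shows "bij_betw (\<lambda>B. n div \<Prod>B) (Pow (prime_factors n)) {m. m dvd n \<and> squarefree (n div m)}"
proof (rule bij_betw_byWitness[where f' = "\<lambda>m. prime_factors (n div m)"])
  have B: "finite B" "\<And>p. p \<in> B \<Longrightarrow> Factorial_Ring.prime p" if "B \<subseteq> prime_factors n" for B
    using that finite_subset by (blast, auto simp: in_prime_factors_iff)
  have dvd: "\<Prod>B dvd n" if "B \<subseteq> prime_factors n" for B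
    using that assms by (rule prod_prime_factors_subset_dvd)
  have sqf: "squarefree (\<Prod>B)" if "B \<subseteq> prime_factors n" for B :: "nat set"
    using B[OF that] by (intro squarefree_prod_coprime squarefree_prime) (auto intro: primes_coprime)
  note nn = dvd_div_div_self[OF _ assms]
  show "\<forall>B\<in>Pow (prime_factors n). prime_factors (n div (n div \<Prod>B)) = B"
    using nn[OF dvd] prime_factors_prod_primes B by simp
  show "(\<lambda>B. n div \<Prod>B) ` Pow (prime_factors n) \<subseteq> {m. m dvd n \<and> squarefree (n div m)}"
  proof clarify
    fix B assume "B \<subseteq> prime_factors n"
    then show "n div \<Prod>B dvd n \<and> squarefree (n div (n div \<Prod>B))"
      using nn[OF dvd] sqf dvd by (metis dvd_triv_left dvd_div_mult_self)
  qed
  show "\<forall>m\<in>{m. m dvd n \<and> squarefree (n div m)}. n div \<Prod>(prime_factors (n div m)) = m"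
    using prod_prime_factors_squarefree nn by simp
  show "(\<lambda>m. prime_factors (n div m)) ` {m. m dvd n \<and> squarefree (n div m)} \<subseteq> Pow (prime_factors n)"
  proof clarify
    fix m p assume m: "m dvd n" and p: "p \<in> prime_factors (n div m)"
    have "n div m dvd n" using m by (metis dvd_div_mult_self dvd_triv_left)
    with assms have "prime_factors (n div m) \<subseteq> prime_factors n"
      by (intro dvd_prime_factors) simp_all
    with p show "p \<in> prime_factors n" by blast
  qed
qed

text \<open>Expanding n times the product of the 1 - 1/p over the primes p of n gives one term for
  each set B of primes, namely n divided by the product of B with sign (-1)^|B|.\<close>

lemma totient_eq_sum_moebius_mu:
  assumes "n > 0"
  shows "int (totient n) = (\<Sum>m | m dvd n. moebius_mu (n div m) * int m)"
proof -
  let ?S = "prime_factors n"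
  \<comment> \<open>The trivial product over \<open>?S - B\<close> keeps the shape produced by
    \<open>prod_add\<close>.\<close>
  have summand: "real_of_int (moebius_mu (n div (n div \<Prod>B)) * int (n div \<Prod>B)) =
      real n * ((\<Prod>p\<in>B. - (1 / real p)) * (\<Prod>p\<in>?S - B. 1))" if "B \<in> Pow ?S" for B
  proof -
    have "B \<subseteq> ?S" using that by simp
    have sqf: "squarefree (n div (n div \<Prod>B))"
      using bij_betw_squarefree_codivisors[OF assms] that by (auto simp: bij_betw_def)
    have dvd: "\<Prod>B dvd n" using \<open>B \<subseteq> ?S\<close> assms by (rule prod_prime_factors_subset_dvd)
    have "finite B" "\<And>p. p \<in> B \<Longrightarrow> Factorial_Ring.prime p"
      using \<open>B \<subseteq> ?S\<close> finite_subset by (blast, auto simp: in_prime_factors_iff)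
    then have "prime_factors (n div (n div \<Prod>B)) = B"
      using dvd_div_div_self[OF dvd assms] by (simp add: prime_factors_prod_primes)
    with sqf have mu: "moebius_mu (n div (n div \<Prod>B)) = (- 1) ^ card B"
      by (simp add: moebius_mu_def)
    have "(\<Prod>p\<in>B. - (1 / real p)) = (- 1) ^ card B / real (\<Prod>B)"
      using prod.distrib[of "\<lambda>_. - 1" "\<lambda>p. 1 / real p" B] by (simp add: prod_dividef)
    then show ?thesis by (simp only: mu) (simp add: real_of_nat_div[OF dvd])
  qed
  have "real_of_int (int (totient n)) = real n * (\<Prod>p\<in>?S. - (1 / real p) + 1)"
    by (simp add: totient_formula2)
  also have "\<dots> = (\<Sum>B\<in>Pow ?S. real n * ((\<Prod>p\<in>B. - (1 / real p)) * (\<Prod>p\<in>?S - B. 1)))"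
    by (subst prod_add) (simp_all add: sum_distrib_left)
  also have "\<dots> = (\<Sum>B\<in>Pow ?S. real_of_int (moebius_mu (n div (n div \<Prod>B)) * int (n div \<Prod>B)))"
    by (intro sum.cong refl summand[symmetric])
  also have "\<dots> = (\<Sum>m | m dvd n \<and> squarefree (n div m). real_of_int (moebius_mu (n div m) * int m))"
    by (rule sum.reindex_bij_betw[OF bij_betw_squarefree_codivisors[OF assms]])
  also have "\<dots> = real_of_int (\<Sum>m | m dvd n. moebius_mu (n div m) * int m)"
    unfolding of_int_sum using assms
    by (intro sum.mono_neutral_left) (auto simp: moebius_mu_def)
  finally show ?thesis by (simp only: of_int_eq_iff)
qed

text \<open>In the Moebius sum for the totient, \<open>D_plus\<close> carries the weight 1,
  \<open>D_minus\<close> the weight -1, and all other divisors the weight 0. Stating it additively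
  avoids truncated subtraction.\<close>

lemma sum_D_plus_eq:
  assumes "n > 0"
  shows "\<Sum>(D_plus n) = \<Sum>(D_minus n) + totient n"
proof -
  have fin: "finite {m. m dvd n}" using assms by simp
  have D: "D_plus n \<subseteq> {m. m dvd n}" "D_minus n \<subseteq> {m. m dvd n}" "D_plus n \<inter> D_minus n = {}"
    by (auto simp: D_plus_def D_minus_def)
  then have finD: "finite (D_plus n)" "finite (D_minus n)"
    using fin finite_subset by blast+
  have mu: "moebius_mu m \<in> {- 1, 0, 1}" for m
    by (cases "even (card (prime_factors m))") (auto simp: moebius_mu_def)
  have "int (totient n) = (\<Sum>m | m dvd n. moebius_mu (n div m) * int m)"
    by (rule totient_eq_sum_moebius_mu[OF assms])
  also have "\<dots> = (\<Sum>m\<in>D_plus n \<union> D_minus n. moebius_mu (n div m) * int m)"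
    using fin D mu by (intro sum.mono_neutral_right) (auto simp: D_plus_def D_minus_def)
  also have "\<dots> = (\<Sum>m\<in>D_plus n. moebius_mu (n div m) * int m) + (\<Sum>m\<in>D_minus n. moebius_mu (n div m) * int m)"
    by (rule sum.union_disjoint[OF finD D(3)])
  also have "(\<Sum>m\<in>D_plus n. moebius_mu (n div m) * int m) = int (\<Sum>(D_plus n))"
    by (auto simp: D_plus_def intro!: sum.cong)
  also have "(\<Sum>m\<in>D_minus n. moebius_mu (n div m) * int m) = - int (\<Sum>(D_minus n))"
    by (auto simp: D_minus_def sum_negf[symmetric] intro!: sum.cong)
  finally show ?thesis by linarith
qed

subsection \<open>The order of a root modulo \<open>k\<close>\<close>

text \<open>A multiple of the order kills the class of \<open>z\<close> in the unit group of the
  quotient, so z^m - 1 lies in the ideal generated by \<open>a\<close>. As \<open>z\<close> is a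
  unit, its class does belong to that group.\<close>

lemma (in cring) pow_ord_cgenideal:
  assumes a: "a \<in> carrier R" and z: "z \<in> Units R"
    and dvd: "group.ord (units_of (R Quot (PIdl a))) (PIdl a +> z) dvd (m :: nat)"
  obtains x where "x \<in> carrier R" "z [^] m = x \<otimes> a \<oplus> \<one>"
proof -
  define I where "I = PIdl a"
  interpret I: ideal I R unfolding I_def by (rule cgenideal_ideal[OF a])
  interpret Q: cring "R Quot I" by (rule I.quotient_is_cring[OF is_cring])
  interpret h: ring_hom_cring R "R Quot I" "(+>) I"
    by (rule ring_hom_cringI[OF is_cring Q.is_cring I.rcos_ring_hom])
  interpret G: group "units_of (R Quot I)" by (rule Q.units_group)
  have zc: "z \<in> carrier R" and inv: "inv z \<in> carrier R" using z by auto
  have zQ: "I +> z \<in> Units (R Quot I)"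
  proof (rule Q.unit_factor)
    have "(I +> z) \<otimes>\<^bsub>R Quot I\<^esub> (I +> inv z) = I +> (z \<otimes> inv z)"
      using zc inv by (simp only: h.hom_mult)
    also have "\<dots> = \<one>\<^bsub>R Quot I\<^esub>" using z by simp
    finally show "(I +> z) \<otimes>\<^bsub>R Quot I\<^esub> (I +> inv z) \<in> Units (R Quot I)" by simp
  qed (use zc inv in \<open>simp_all only: h.hom_closed\<close>)
  \<comment> \<open>This covers infinite order too: \<open>ord\<close> is then 0, which divides only
    \<open>m = 0\<close>.\<close>
  have "(I +> z) [^]\<^bsub>units_of (R Quot I)\<^esub> m = \<one>\<^bsub>units_of (R Quot I)\<^esub>"
    using dvd zQ by (subst G.pow_eq_id) (simp_all add: I_def units_of_carrier)
  then have "(I +> z) [^]\<^bsub>R Quot I\<^esub> m = \<one>\<^bsub>R Quot I\<^esub>"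
    using zQ by (simp add: Q.units_of_pow units_of_one)
  moreover have "I +> (z [^] (i :: nat)) = (I +> z) [^]\<^bsub>R Quot I\<^esub> i" for i
    using zc by (induction i) (simp_all only: nat_pow_0 nat_pow_Suc Q.nat_pow_0 Q.nat_pow_Suc
      h.hom_one h.hom_mult nat_pow_closed)
  ultimately have "I +> (z [^] m) = I +> \<one>" by (simp only: h.hom_one)
  then have "z [^] m \<ominus> \<one> \<in> I"
    using quotient_eq_iff_same_a_r_cos[OF I.is_ideal] zc by simp
  then have "\<exists>x. z [^] m \<ominus> \<one> = x \<otimes> a \<and> x \<in> carrier R"
    unfolding I_def cgenideal_def by (rule CollectD)
  then obtain x where x: "x \<in> carrier R" "z [^] m \<ominus> \<one> = x \<otimes> a"
    by (elim exE conjE)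
  have "z [^] m = z [^] m \<ominus> \<one> \<oplus> \<one>" using zc by (simp add: minus_eq a_assoc l_neg)
  also have "\<dots> = x \<otimes> a \<oplus> \<one>" by (simp only: x(2))
  finally show ?thesis by (rule that[OF x(1)])
qed

section \<open>The ring of integers inside the complex numbers\<close>

lemma complex_ring_simps:
  "carrier complex_ring = UNIV" "x \<otimes>\<^bsub>complex_ring\<^esub> y = x * y" "\<one>\<^bsub>complex_ring\<^esub> = 1"
  "x \<oplus>\<^bsub>complex_ring\<^esub> y = x + y" "\<zero>\<^bsub>complex_ring\<^esub> = 0"
  by (simp_all add: ring_of_type_algebra_def)

interpretation complex_ring: cring complex_ring
  by (rule cring_from_type_algebra)

lemma complex_ring_a_inv: "\<ominus>\<^bsub>complex_ring\<^esub> x = - x"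
  by (rule complex_ring.minus_equality) (simp_all add: complex_ring_simps)

lemma complex_ring_m_inv: "x \<noteq> 0 \<Longrightarrow> inv\<^bsub>complex_ring\<^esub> x = inverse x"
  by (rule complex_ring.comm_inv_char) (simp_all add: complex_ring_simps)

lemma ring_of_integers_simps:
  "x \<otimes>\<^bsub>ring_of_integers K\<^esub> y = x * y" "\<one>\<^bsub>ring_of_integers K\<^esub> = 1"
  "x \<oplus>\<^bsub>ring_of_integers K\<^esub> y = x + y"
  "carrier (ring_of_integers K) = {z \<in> K. algebraic_int z}"
  by (simp_all add: ring_of_integers_def complex_ring_simps)

lemma ring_of_integers_cring:
  assumes "subfield K complex_ring"
  shows "cring (ring_of_integers K)"
proof -
  note K = subringE[OF subfieldE(1)[OF assms], unfolded complex_ring_simps complex_ring_a_inv]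
  have "subring {z \<in> K. algebraic_int z} complex_ring"
    by (rule complex_ring.subringI)
       (use K in \<open>auto simp: complex_ring_simps complex_ring_a_inv intro: algebraic_int_mult algebraic_int_add\<close>)
  then show ?thesis
    unfolding ring_of_integers_def
    by (subst complex_ring.subcring_iff[symmetric])
       (simp_all add: complex_ring.subcringI' complex_ring_simps)
qed

lemma ring_of_integers_pow: "x [^]\<^bsub>ring_of_integers K\<^esub> (m :: nat) = x ^ m"
  by (induction m) (simp_all add: ring_of_integers_simps nat_pow_def mult.commute)

lemma splitting_field_subfield: "subfield (splitting_field P) complex_ring"
  unfolding splitting_field_def
  by (rule field.generate_field_is_subfield[OF field_from_type_algebra]) (simp add: complex_ring_simps)

text \<open>Multiplying \<open>P\<close> by its constant coefficient, which is its own inverse,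
  makes that coefficient 1. The reversed polynomial is then monic and has the root 1/z.\<close>

lemma algebraic_int_inverse_root:
  fixes P :: "int poly" and z :: "'a :: field_char_0"
  assumes P0: "Polynomial.coeff P 0 = 1 \<or> Polynomial.coeff P 0 = - 1"
    and root: "poly (map_poly of_int P) z = 0"
  shows "algebraic_int (inverse z)"
proof (rule algebraic_int_inverse)
  let ?c = "Polynomial.coeff P 0"
  let ?p = "Polynomial.smult (of_int ?c) (map_poly of_int P) :: 'a poly"
  show "poly ?p z = 0" using root by simp
  show "\<forall>i. Polynomial.coeff ?p i \<in> \<int>" by (simp add: coeff_map_poly)
  show "Polynomial.coeff ?p 0 = 1" using P0 by (auto simp: coeff_map_poly)
qed

text \<open>The constant coefficient of \<open>P\<close> makes the root \<open>z\<close> a unit of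
  the ring of integers, so the statement on orders in quotients applies to the ideal generated by
  \<open>k\<close>.\<close>

lemma power_congruent_one_if_class_order_dvd:
  fixes P :: "int poly" and z :: complex
  assumes P: "lead_coeff P = 1" "Polynomial.coeff P 0 = 1 \<or> Polynomial.coeff P 0 = - 1"
    and root: "poly (map_poly of_int P) z = 0"
    and dvd: "class_order (ring_of_integers (splitting_field P)) k z dvd m"
  obtains x where "algebraic_int x" "z ^ m = of_int k * x + 1"
proof -
  define K where "K = splitting_field P"
  define R where "R = ring_of_integers K"
  have subK: "subfield K complex_ring" unfolding K_def by (rule splitting_field_subfield)
  interpret R: cring R unfolding R_def by (rule ring_of_integers_cring[OF subK])
  have z: "algebraic_int z" using P root by (auto simp: algebraic_int_altdef_ipoly)
  have zi: "algebraic_int (inverse z)" by (rule algebraic_int_inverse_root[OF P(2) root])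
  have z0: "z \<noteq> 0" using root P(2) by (auto simp: poly_0_coeff_0 coeff_map_poly)
  have zK: "z \<in> K"
    unfolding K_def splitting_field_def by (rule generate_field.incl) (use root in simp)
  have kK: "of_int k \<in> K"
    unfolding K_def splitting_field_def by (rule generate_field.incl) simp
  have ziK: "inverse z \<in> K"
    using complex_ring.subfield_m_inv(1)[OF subK, of z] zK z0
    by (simp add: complex_ring_simps complex_ring_m_inv)
  have zU: "z \<in> Units R"
    unfolding Units_def using z zi zK ziK z0
    by (auto simp: R_def ring_of_integers_simps intro!: bexI[of _ "inverse z"])
  have kR: "of_int k \<in> carrier R" using kK by (simp add: R_def ring_of_integers_simps)
  have ord: "group.ord (units_of (R Quot (PIdl\<^bsub>R\<^esub> (of_int k)))) (PIdl\<^bsub>R\<^esub> (of_int k) +>\<^bsub>R\<^esub> z) dvd m"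
    using dvd by (simp add: class_order_def quot_units_def R_def K_def)
  obtain x where "x \<in> carrier R" "z [^]\<^bsub>R\<^esub> m = x \<otimes>\<^bsub>R\<^esub> of_int k \<oplus>\<^bsub>R\<^esub> \<one>\<^bsub>R\<^esub>"
    by (rule R.pow_ord_cgenideal[OF kR zU ord])
  then show ?thesis
    by (intro that[of x]) (simp_all add: R_def ring_of_integers_simps ring_of_integers_pow mult.commute)
qed

section \<open>Divisibility of the resultant\<close>

lemma U_eq_prod_diff:
  fixes n :: nat
  defines "ns \<equiv> sorted_list_of_set (D_plus n)" and "ms \<equiv> sorted_list_of_set (D_minus n)"
  shows "U d \<alpha> n =
    (\<Prod>j\<in>{..<length ns} \<rightarrow>\<^sub>E {1..d}. \<Prod>l\<in>{..<length ms} \<rightarrow>\<^sub>E {1..d}.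
       monomial_value \<alpha> ns j - monomial_value \<alpha> ms l)"
  by (simp add: U_def P_mset_def ns_def ms_def Res_P_list)

lemma monomial_value_const:
  "monomial_value \<alpha> ns (\<lambda>i\<in>{..<length ns}. j) = \<alpha> j ^ sum_list ns"
  by (simp add: monomial_value_def power_sum sum_list_sum_nth lessThan_atLeast0)

lemma algebraic_int_monomial_value:
  assumes "\<And>j. j \<in> {1..d} \<Longrightarrow> algebraic_int (\<alpha> j)" "j \<in> {..<length ns} \<rightarrow>\<^sub>E {1..d}"
  shows "algebraic_int (monomial_value \<alpha> ns j)"
  unfolding monomial_value_def using assms
  by (intro algebraic_int_prod algebraic_int_power) (auto simp: PiE_iff)

theorem theorem8p22:
  fixes P :: "int poly" and d n :: nat and \<alpha> :: "nat \<Rightarrow> complex" and k :: int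
  assumes "lead_coeff P = 1" and "Polynomial.degree P = d"
    and "Polynomial.coeff P 0 = 1 \<or> Polynomial.coeff P 0 = - 1"
    and "map_poly of_int P = (\<Prod>j=1..d. [:- \<alpha> j, 1:])"
    and "n > 1"
    and "\<exists>j\<in>{1..d}. class_order (ring_of_integers (splitting_field P)) k (\<alpha> j) dvd totient n"
  shows "\<exists>u::int. U d \<alpha> n = of_int u \<and> k dvd u"
proof -
  have root: "poly (map_poly of_int P) (\<alpha> j) = 0" if "j \<in> {1..d}" for j
    using that by (auto simp: assms(4) poly_prod)
  have int: "algebraic_int (\<alpha> j)" if "j \<in> {1..d}" for j
    using root[OF that] assms(1) by (auto simp: algebraic_int_altdef_ipoly)
  have fin: "finite (D_plus n)" "finite (D_minus n)"
    using assms(5) by (auto intro: finite_subset[of _ "{m. m dvd n}"] simp: D_plus_def D_minus_def)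
  define ns where "ns = sorted_list_of_set (D_plus n)"
  define ms where "ms = sorted_list_of_set (D_minus n)"
  define S where "S = {..<length ns} \<rightarrow>\<^sub>E {1..d}"
  define T where "T = {..<length ms} \<rightarrow>\<^sub>E {1..d}"
  have finS: "finite S" and finT: "finite T" by (simp_all add: S_def T_def finite_PiE)
  let ?f = "monomial_value \<alpha> ns" and ?g = "monomial_value \<alpha> ms"
  have U: "U d \<alpha> n = (\<Prod>j\<in>S. \<Prod>l\<in>T. ?f j - ?g l)"
    using U_eq_prod_diff by (simp add: ns_def ms_def S_def T_def)

  \<comment> \<open>The product of the linear factors is \<open>P\<close>, whose coefficients are
    integers.\<close>
  have power_sum: "(\<Sum>j=1..d. \<alpha> j ^ m) \<in> \<rat>" for m
  proof (rule Rats_power_sums_if_coeffs)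
    show "Polynomial.coeff (\<Prod>j=1..d. [:- \<alpha> j, 1:]) i \<in> \<rat>" for i
      unfolding assms(4)[symmetric] by (simp add: coeff_map_poly)
  qed simp
  have rat: "U d \<alpha> n \<in> \<rat>"
    unfolding U
    by (rule Rats_power_sums_prod_diff[OF finS finT])
       (unfold S_def T_def power_sum_monomial_value, (intro Rats_prod power_sum)+)

  obtain j where j: "j \<in> {1..d}"
    and ord: "class_order (ring_of_integers (splitting_field P)) k (\<alpha> j) dvd totient n"
    using assms(6) by blast
  obtain x where x: "algebraic_int x" "\<alpha> j ^ totient n = of_int k * x + 1"
    by (rule power_congruent_one_if_class_order_dvd[OF assms(1,3) root[OF j] ord])
  \<comment> \<open>The constant tuples, which pick the root \<alpha> j in every position, single
    out the factor divisible by \<open>k\<close>.\<close>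
  define s where "s = (\<lambda>i\<in>{..<length ns}. j)"
  define t where "t = (\<lambda>i\<in>{..<length ms}. j)"
  have st: "s \<in> S" "t \<in> T" using j by (auto simp: s_def t_def S_def T_def)
  have sum: "sum_list ns = sum_list ms + totient n"
    using sum_D_plus_eq[of n] assms(5) fin
    by (simp add: ns_def ms_def distinct_sum_list_conv_Sum)
  have st_diff: "?f s - ?g t = of_int k * (\<alpha> j ^ sum_list ms * x)"
    by (simp add: s_def t_def monomial_value_const sum power_add x(2) algebra_simps)
  \<comment> \<open>All remaining factors: the rest of row \<open>s\<close>, and every other row in
    full.\<close>
  define r where "r = (\<Prod>l\<in>T - {t}. ?f s - ?g l) * (\<Prod>i\<in>S - {s}. \<Prod>l\<in>T. ?f i - ?g l)"
  have "U d \<alpha> n = (?f s - ?g t) * r"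
    unfolding U r_def using prod.remove[OF finS st(1), of "\<lambda>i. \<Prod>l\<in>T. ?f i - ?g l"]
      prod.remove[OF finT st(2), of "\<lambda>l. ?f s - ?g l"] by (simp add: mult.assoc)
  then have Uk: "U d \<alpha> n = of_int k * (\<alpha> j ^ sum_list ms * x * r)"
    by (simp add: st_diff)
  have "algebraic_int (?f i - ?g l)" if "i \<in> S" "l \<in> T" for i l
    using that unfolding S_def T_def by (intro algebraic_int_diff algebraic_int_monomial_value int)
  then have "algebraic_int r"
    unfolding r_def using st by (intro algebraic_int_mult algebraic_int_prod) simp_all
  then have y: "algebraic_int (\<alpha> j ^ sum_list ms * x * r)"
    using x int[OF j] by (intro algebraic_int_mult algebraic_int_power)
  show ?thesis
  \<comment> \<open>For \<open>k = 0\<close> the factorization already gives U = 0. Otherwise the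
    cofactor is U/k, which is rational as well as an algebraic integer, hence an integer.\<close>
  proof (cases "k = 0")
    case True
    then show ?thesis using Uk by (intro exI[of _ 0]) simp
  next
    case False
    then have "\<alpha> j ^ sum_list ms * x * r = U d \<alpha> n / of_int k" using Uk by simp
    also have "\<dots> \<in> \<rat>" using rat by simp
    finally have "\<alpha> j ^ sum_list ms * x * r \<in> \<int>"
      using y rational_algebraic_int_is_int by blast
    then obtain v where "\<alpha> j ^ sum_list ms * x * r = of_int v" by (auto elim: Ints_cases)
    then show ?thesis using Uk by (intro exI[of _ "k * v"]) simp
  qed
qed

end
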